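(* Fix $C\ge1$. Let $N,M:(0,1]\to\mathbb{N}$ be functions with $N(\delta)\to\infty$ as $\delta\to0^+$ and $$\lim_{\delta\to0^+}\frac{N(C\delta)}{\log\bigl(\delta^{-1}M(\delta)\bigr)}=+\infty.$$ Let $\mathcal{F}$ be a family of functions $[0,1]^d\to\mathbb{R}^d$ such that (I) $C^{-1}\|x-y\|_\infty\le\|f(x)-f(y)\|_\infty\le\|x-y\|_\infty$ for all $x,y\in[0,1]^d$ and all $f\in\mathcal{F}$; (II) $|\mathcal{F}|_\delta\le M(\delta)$ for all sufficiently small $\delta>0$. Then for every $N$-large set $A\subset[0,1]^d$ there exists a compact set $B\subset\mathbb{R}^d$ with $|B|=0$ such that $[0,1]^d\subset f(A)+B$ for all $f\in\mathcal{F}$.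
   Context: $|\mathcal{F}|_\delta$ is the covering number of $\mathcal{F}$ in the $L^\infty([0,1]^d)$ norm: the least $M$ such that there exist $f_1,\dots,f_M\in\mathcal{F}$ with $\min_i\|f-f_i\|_{L^\infty([0,1]^d)}\le\delta$ for all $f\in\mathcal{F}$ ($\infty$ if none exists). For $E\subset\mathbb{R}^d$, $|E|_\delta$ is the smallest number of balls of radius $\delta$ covering $E$. For $N:(0,1]\to\mathbb{N}$ with $N(\delta)\to\infty$, a Borel set $A$ is $N$-large if there is a nonempty compact $A'\subset A$ such that for every (closed, axis-parallel) cube $Q$ with $A'\cap Q^\circ\neq\emptyset$ ($Q^\circ$ the interior), $\limsup_{\delta\to0^+}|A'\cap Q^\circ|_\delta/N(\delta)\ge1$. $|B|$ is Lebesgue measure. *)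

theory Defs
  imports "HOL-Analysis.Analysis" "HOL-Library.Extended_Nat"
begin

definition unit_cube :: "(real^'n) set" where
  "unit_cube = cbox 0 One"

definition ball_cover_num :: "(real^'n) set \<Rightarrow> real \<Rightarrow> nat" where
  "ball_cover_num E \<delta> =
     Inf {card S | S. finite S \<and> E \<subseteq> (\<Union>c\<in>S. cball c \<delta>)}"

text \<open>|F|_delta: covering number of F in the L^infinity([0,1]^d) norm
  (sup-norm of the l^infinity norm of the difference); infinity if no finite cover.\<close>
definition fun_cover_num ::
  "((real^'n) \<Rightarrow> (real^'n)) set \<Rightarrow> real \<Rightarrow> enat" where
  "fun_cover_num F \<delta> =
     Inf {enat (card S) | S. finite S \<and> S \<subseteq> F \<and>
          (\<forall>f\<in>F. \<exists>g\<in>S. (SUP x\<in>unit_cube. infnorm (f x - g x)) \<le> \<delta>)}"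

definition axis_cube :: "(real^'n) set \<Rightarrow> bool" where
  "axis_cube Q \<longleftrightarrow> (\<exists>a r. r > 0 \<and> Q = cbox a (a + r *\<^sub>R One))"

definition N_large :: "(real \<Rightarrow> nat) \<Rightarrow> (real^'n) set \<Rightarrow> bool" where
  "N_large N A \<longleftrightarrow> A \<in> sets borel \<and>
     (\<exists>A'. A' \<noteq> {} \<and> compact A' \<and> A' \<subseteq> A \<and>
        (\<forall>Q. axis_cube Q \<and> A' \<inter> interior Q \<noteq> {} \<longrightarrow>
           Limsup (at_right 0)
             (\<lambda>\<delta>. ereal (real (ball_cover_num (A' \<inter> interior Q) \<delta>) / real (N \<delta>))) \<ge> 1))"

end

theory Submission
  imports Defs
begin

text \<open>
  The set \<open>B\<close> is a decreasing intersection of compact sets \<open>B\<^sub>k\<close> with measure tending to \<open>0\<close>, such that for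
  all \<open>f\<close> and \<open>y\<close> some \<open>x \<in> A'\<close> has a whole cube around \<open>y - f x\<close> inside \<open>B\<^sub>k\<close>; compactness of \<open>A'\<close>
  then puts some \<open>y - f x\<close> into the intersection. To shrink \<open>B\<^sub>k\<close>, cover \<open>A'\<close> by finitely many small cubes \<open>Q\<close>.
  At a suitable scale \<open>\<delta>\<close> (depending on \<open>Q\<close>) the set \<open>A' \<inter> Q\<close> contains \<open>n \<ge> N(C\<delta>) / 2\<close> points separated
  by \<open>C\<delta>\<close>. For each of the at most \<open>T = M(\<delta>) (c/\<delta>)\<^sup>d\<close> discretised pairs \<open>(f, y)\<close> the points \<open>y - f x\<close> lie in \<open>n\<close>
  different cells of a grid of mesh about \<open>\<delta>\<close> in a bounded window. A greedy choice yields a set of cells meeting all these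
  \<open>n\<close>-sets whose proportion in the window is about \<open>ln T / n\<close>, which is small by the hypothesis on \<open>N\<close> and \<open>M\<close>.
\<close>

section \<open>The sup norm in coordinates and the unit cube\<close>

lemma infnorm_le_cart_iff:
  fixes x :: "real^'n"
  shows "infnorm x \<le> r \<longleftrightarrow> (\<forall>i. \<bar>x $ i\<bar> \<le> r)"
proof
  assume "infnorm x \<le> r"
  then show "\<forall>i. \<bar>x $ i\<bar> \<le> r"
    using component_le_infnorm_cart[of x] order_trans by blast
next
  assume "\<forall>i. \<bar>x $ i\<bar> \<le> r"
  then show "infnorm x \<le> r"
    unfolding infnorm_Max by (auto simp: Basis_vec_def inner_axis)
qed

lemma sum_Basis_cart_nth [simp]: "(\<Sum>b\<in>Basis. (b :: real^'n) $ i) = 1"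
proof -
  have "(\<Sum>b\<in>Basis. (b :: real^'n) $ i) = (\<Sum>b\<in>Basis. b \<bullet> (axis i 1 :: real^'n))"
    by (simp add: inner_axis)
  also have "\<dots> = (\<Sum>b\<in>Basis. if b = (axis i 1 :: real^'n) then 1 else 0)"
    by (intro sum.cong) (auto simp: inner_Basis axis_in_Basis_iff)
  also have "\<dots> = 1" by (simp add: axis_in_Basis_iff)
  finally show ?thesis .
qed

lemma mem_unit_cube_iff: "x \<in> unit_cube \<longleftrightarrow> (\<forall>i. 0 \<le> x $ i \<and> x $ i \<le> 1)"
  by (simp add: unit_cube_def mem_box_cart)

lemma zero_in_unit_cube: "0 \<in> unit_cube"
  by (simp add: mem_unit_cube_iff)

lemma infnorm_le_1_unit_cube: "x \<in> unit_cube \<Longrightarrow> infnorm x \<le> 1"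
  by (auto simp: infnorm_le_cart_iff mem_unit_cube_iff)

lemma infnorm_triangle_sub: "infnorm (x - z) \<le> infnorm (x - y) + infnorm (y - z)"
  using infnorm_triangle[of "x - y" "y - z"] by simp

section \<open>Separated sets and greedy hitting sets\<close>

text \<open>Points can be added one at a time: fewer than \<open>ball_cover_num E \<delta>\<close>
  balls centred at the points chosen so far cannot cover \<open>E\<close>, and an uncovered point
  has distance more than \<delta> from all of them.\<close>

lemma separated_subset_of_ball_cover_num:
  assumes "0 \<le> \<delta>" "k \<le> ball_cover_num E \<delta>"
  shows "\<exists>S. finite S \<and> card S = k \<and> S \<subseteq> E \<and> (\<forall>x\<in>S. \<forall>y\<in>S. x \<noteq> y \<longrightarrow> \<delta> < dist x y)"
  using assms(2)
proof (induction k)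
  case 0
  show ?case by (intro exI[of _ "{}"]) auto
next
  case (Suc k)
  then obtain S where S: "finite S" "card S = k" "S \<subseteq> E"
      "\<forall>x\<in>S. \<forall>y\<in>S. x \<noteq> y \<longrightarrow> \<delta> < dist x y"
    by auto
  have "\<not> E \<subseteq> (\<Union>c\<in>S. cball c \<delta>)"
  proof
    assume "E \<subseteq> (\<Union>c\<in>S. cball c \<delta>)"
    then have "ball_cover_num E \<delta> \<le> k"
      unfolding ball_cover_num_def using S(1,2) by (intro cInf_lower) auto
    with Suc.prems show False by simp
  qed
  then obtain e where e: "e \<in> E" "\<And>c. c \<in> S \<Longrightarrow> \<delta> < dist c e"
    by (force simp: not_le)
  then have "e \<notin> S" using assms(1) by force
  then show ?case
    using S e by (intro exI[of _ "insert e S"]) (auto simp: dist_commute)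
qed

text \<open>Double counting of the pairs with \<open>g \<in> X\<close>: there are at least
  \<open>n * card U\<close> of them, so some \<open>g\<close> lies in at least the average number of
  sets.\<close>

lemma greedy_step:
  fixes U :: "'a set set"
  assumes "finite G" "finite U" "G \<noteq> {}"
    and "\<And>X. X \<in> U \<Longrightarrow> X \<subseteq> G \<and> n \<le> card X"
  shows "\<exists>g\<in>G. real n / real (card G) * real (card U) \<le> real (card {X \<in> U. g \<in> X})"
proof (rule ccontr)
  assume "\<not> ?thesis"
  then have lt: "\<And>g. g \<in> G \<Longrightarrow> real (card {X \<in> U. g \<in> X}) < real n / real (card G) * real (card U)"
    by force
  have "real n * real (card U) \<le> (\<Sum>X\<in>U. real (card X))"
    using sum_mono[of U "\<lambda>_. real n" "\<lambda>X. real (card X)"] assms(4) by (simp add: mult.commute)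
  also have "\<dots> = (\<Sum>X\<in>U. \<Sum>g\<in>G. if g \<in> X then 1 else 0)"
  proof (rule sum.cong[OF refl])
    fix X assume "X \<in> U"
    then have "{g \<in> G. g \<in> X} = X" using assms(4) by auto
    then show "real (card X) = (\<Sum>g\<in>G. if g \<in> X then 1 else 0)"
      using assms(1) by (simp flip: sum.inter_filter)
  qed
  also have "\<dots> = (\<Sum>g\<in>G. \<Sum>X\<in>U. if g \<in> X then 1 else 0)"
    by (rule sum.swap)
  also have "\<dots> = (\<Sum>g\<in>G. real (card {X \<in> U. g \<in> X}))"
    using assms(2) by (simp flip: sum.inter_filter)
  also have "\<dots> < (\<Sum>g\<in>G. real n / real (card G) * real (card U))"
    using assms lt by (intro sum_strict_mono) auto
  also have "\<dots> = real n * real (card U)"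
    using assms by simp
  finally show False by simp
qed

text \<open>Each step adds the point that \<open>greedy_step\<close> provides for the sets still
  missed, which shrinks their number at least by the factor \<open>1 - n / card G\<close>.\<close>

lemma greedy_iterate:
  fixes T :: "'a set set"
  assumes "finite G" "finite T" "G \<noteq> {}" "n \<le> card G"
    and "\<And>X. X \<in> T \<Longrightarrow> X \<subseteq> G \<and> n \<le> card X"
  shows "\<exists>S\<subseteq>G. card S \<le> s \<and>
    real (card {X \<in> T. X \<inter> S = {}}) \<le> real (card T) * (1 - real n / real (card G)) ^ s"
proof (induction s)
  case 0
  show ?case by (intro exI[of _ "{}"]) auto
next
  case (Suc s)
  then obtain S where S: "S \<subseteq> G" "card S \<le> s"
    "real (card {X \<in> T. X \<inter> S = {}}) \<le> real (card T) * (1 - real n / real (card G)) ^ s"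
    by auto
  define U where "U = {X \<in> T. X \<inter> S = {}}"
  let ?q = "1 - real n / real (card G)"
  have q: "0 \<le> ?q" using assms by (auto simp: divide_simps)
  have fU: "finite U" using assms(2) by (simp add: U_def)
  obtain g where g: "g \<in> G" "real n / real (card G) * real (card U) \<le> real (card {X \<in> U. g \<in> X})"
    using greedy_step[of G U n] assms fU by (auto simp: U_def)
  have "{X \<in> T. X \<inter> insert g S = {}} = U - {X \<in> U. g \<in> X}"
    by (auto simp: U_def)
  then have "real (card {X \<in> T. X \<inter> insert g S = {}}) = real (card U) - real (card {X \<in> U. g \<in> X})"
    using fU by (simp add: card_Diff_subset card_mono of_nat_diff)
  also have "\<dots> \<le> ?q * real (card U)" using g(2) by (simp add: algebra_simps)
  also have "\<dots> \<le> ?q * (real (card T) * ?q ^ s)"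
    using S(3) q unfolding U_def by (intro mult_left_mono)
  finally have "real (card {X \<in> T. X \<inter> insert g S = {}}) \<le> real (card T) * ?q ^ Suc s"
    by (simp add: algebra_simps)
  moreover have "card (insert g S) \<le> Suc s"
    using S(2) card_insert_le_m1[of "Suc s" S g] by simp
  ultimately show ?case
    using S(1) g(1) by (intro exI[of _ "insert g S"]) auto
qed

text \<open>By \<open>1 - x \<le> exp (- x)\<close>, after more than
  \<open>card G / n * ln (card T)\<close> greedy steps fewer than one set is missed, and a count
  below one is zero.\<close>

lemma greedy_hitting_set:
  fixes T :: "'a set set"
  assumes "finite G" "finite T" "T \<noteq> {}" "0 < n"
    and TG: "\<And>X. X \<in> T \<Longrightarrow> X \<subseteq> G \<and> n \<le> card X"
  shows "\<exists>S\<subseteq>G. (\<forall>X\<in>T. X \<inter> S \<noteq> {}) \<and>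
    real (card S) \<le> real (card G) / real n * ln (real (card T)) + 1"
proof -
  obtain X0 where "X0 \<in> T" using assms by auto
  then have nG: "n \<le> card G" using TG card_mono[OF assms(1)] le_trans by blast
  then have G: "G \<noteq> {}" "0 < card G" using assms by auto
  define t where "t = real (card G) / real n * ln (real (card T))"
  \<comment> \<open>The least integer strictly above \<open>t\<close>: strictness brings the final
    count strictly below one, and \<open>s \<le> t + 1\<close> gives the summand 1 of the
    bound.\<close>
  define s where "s = nat \<lfloor>t\<rfloor> + 1"
  have T: "1 \<le> card T" using assms by (simp add: Suc_leI card_gt_0_iff)
  then have t0: "0 \<le> t" by (simp add: t_def)
  have s: "t < real s" "real s \<le> t + 1"
    using t0 unfolding s_def by linarith+
  obtain S where S: "S \<subseteq> G" "card S \<le> s"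
    "real (card {X \<in> T. X \<inter> S = {}}) \<le> real (card T) * (1 - real n / real (card G)) ^ s"
    using greedy_iterate[OF assms(1,2) G(1) nG TG] by blast
  have "(1 - real n / real (card G)) ^ s \<le> exp (- (real n / real (card G))) ^ s"
    using nG G exp_ge_add_one_self[of "- (real n / real (card G))"]
    by (intro power_mono) (auto simp: divide_simps)
  also have "\<dots> = exp (- (real n / real (card G) * real s))"
    using exp_of_nat_mult[of s "- (real n / real (card G))"] by (simp add: mult.commute)
  also have "\<dots> < exp (- ln (real (card T)))"
  proof -
    have "ln (real (card T)) = real n / real (card G) * t"
      using G \<open>0 < n\<close> by (simp add: t_def)
    also have "\<dots> < real n / real (card G) * real s"
      using s(1) G \<open>0 < n\<close> by (intro mult_strict_left_mono) auto
    finally show ?thesis by simp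
  qed
  also have "\<dots> = 1 / real (card T)"
    using T by (simp add: exp_minus inverse_eq_divide)
  finally have "real (card T) * (1 - real n / real (card G)) ^ s < real (card T) * (1 / real (card T))"
    using T by (intro mult_strict_left_mono) auto
  also have "\<dots> = 1" using T by simp
  finally have "real (card T) * (1 - real n / real (card G)) ^ s < 1" .
  then have "real (card {X \<in> T. X \<inter> S = {}}) < 1"
    using S(3) by (rule le_less_trans[rotated])
  then have "card {X \<in> T. X \<inter> S = {}} = 0" by simp
  then have "\<forall>X\<in>T. X \<inter> S \<noteq> {}" using assms(2) by auto
  moreover have "real (card S) \<le> t + 1"
    using S(2) s(2) by linarith
  ultimately show ?thesis using S(1) unfolding t_def by (intro exI[of _ S]) simp
qed

section \<open>Integer boxes and grid cells\<close>

lemma int_box_eq_image: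
  "{k :: int^'n. \<forall>i. \<bar>real_of_int (k $ i)\<bar> \<le> t} =
    vec_lambda ` (PiE UNIV (\<lambda>_. {-\<lfloor>t\<rfloor>..\<lfloor>t\<rfloor>}))"
proof -
  have "k \<in> vec_lambda ` (PiE UNIV (\<lambda>_. {-\<lfloor>t\<rfloor>..\<lfloor>t\<rfloor>}))"
    if "\<forall>i. \<bar>real_of_int (k $ i)\<bar> \<le> t" for k :: "int^'n"
  proof (rule image_eqI)
    show "k = vec_lambda (vec_nth k)" by simp
    have "- \<lfloor>t\<rfloor> \<le> k $ i \<and> k $ i \<le> \<lfloor>t\<rfloor>" for i
      using that[rule_format, of i] by linarith
    then show "vec_nth k \<in> PiE UNIV (\<lambda>_. {-\<lfloor>t\<rfloor>..\<lfloor>t\<rfloor>})" by auto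
  qed
  moreover have "\<bar>real_of_int j\<bar> \<le> t" if "- \<lfloor>t\<rfloor> \<le> j" "j \<le> \<lfloor>t\<rfloor>" for j
    using that by linarith
  ultimately show ?thesis by (auto simp: PiE_iff)
qed

lemma finite_int_box: "finite {k :: int^'n. \<forall>i. \<bar>real_of_int (k $ i)\<bar> \<le> t}"
  unfolding int_box_eq_image by (intro finite_imageI finite_PiE) auto

lemma card_int_box_le:
  assumes "0 \<le> t"
  shows "real (card {k :: int^'n. \<forall>i. \<bar>real_of_int (k $ i)\<bar> \<le> t}) \<le> (2 * t + 1) ^ CARD('n)"
proof -
  have "card {k :: int^'n. \<forall>i. \<bar>real_of_int (k $ i)\<bar> \<le> t}
      \<le> card (PiE (UNIV :: 'n set) (\<lambda>_. {-\<lfloor>t\<rfloor>..\<lfloor>t\<rfloor>}))"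
    unfolding int_box_eq_image by (intro card_image_le finite_PiE) auto
  also have "\<dots> = nat (2 * \<lfloor>t\<rfloor> + 1) ^ CARD('n)"
    by (simp add: card_PiE algebra_simps)
  finally have "real (card {k :: int^'n. \<forall>i. \<bar>real_of_int (k $ i)\<bar> \<le> t})
      \<le> real (nat (2 * \<lfloor>t\<rfloor> + 1)) ^ CARD('n)"
    by (metis of_nat_le_iff of_nat_power)
  also have "\<dots> \<le> (2 * t + 1) ^ CARD('n)"
    using assms by (intro power_mono) linarith+
  finally show ?thesis .
qed

text \<open>The lower corner of the half-open cell with index \<open>k\<close>. Half-open cells give
  every point exactly one index, so that the greedy argument can count indices instead of
  points.\<close>

definition grid_point :: "real \<Rightarrow> int^'n \<Rightarrow> real^'n" where
  "grid_point h k = (\<chi> i. h * real_of_int (k $ i))"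

definition grid_cell :: "real \<Rightarrow> real^'n \<Rightarrow> int^'n" where
  "grid_cell h z = (\<chi> i. \<lfloor>z $ i / h\<rfloor>)"

lemma grid_point_cell_nth:
  assumes "0 < h"
  shows "grid_point h (grid_cell h z) $ i \<le> z $ i" "z $ i < grid_point h (grid_cell h z) $ i + h"
proof -
  show "grid_point h (grid_cell h z) $ i \<le> z $ i"
    "z $ i < grid_point h (grid_cell h z) $ i + h"
    using floor_divide_lower[OF assms, of "z $ i"] floor_divide_upper[OF assms, of "z $ i"]
    by (simp_all add: grid_point_def grid_cell_def algebra_simps)
qed

lemma infnorm_grid_point_cell:
  assumes "0 < h"
  shows "infnorm (z - grid_point h (grid_cell h z)) \<le> h"
  unfolding infnorm_le_cart_iff
proof
  fix i
  show "\<bar>(z - grid_point h (grid_cell h z)) $ i\<bar> \<le> h"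
    using grid_point_cell_nth[OF assms, of z i] by simp
qed

lemma infnorm_same_grid_cell:
  assumes "0 < h" "grid_cell h z = grid_cell h w"
  shows "infnorm (z - w) \<le> h"
  unfolding infnorm_le_cart_iff
proof
  fix i
  show "\<bar>(z - w) $ i\<bar> \<le> h"
    using grid_point_cell_nth[OF assms(1), of z i] grid_point_cell_nth[OF assms(1), of w i] assms(2)
    by simp
qed

lemma abs_grid_cell_nth_le:
  assumes "0 < h" "infnorm z \<le> b"
  shows "\<bar>real_of_int (grid_cell h z $ i)\<bar> \<le> b / h + 1"
proof -
  have "\<bar>z $ i\<bar> \<le> b" using assms(2) by (simp add: infnorm_le_cart_iff)
  then have "\<bar>z $ i\<bar> / h \<le> b / h" using assms(1) by (simp add: divide_right_mono)
  then have "\<bar>z $ i / h\<bar> \<le> b / h" using assms(1) by (simp add: abs_divide)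
  then show ?thesis unfolding grid_cell_def vec_lambda_beta by linarith
qed

text \<open>For fixed \<open>f\<close> and a cell \<open>k\<close> of the unit cube, the points
  \<open>grid_point h k - f x\<close> with \<open>x \<in> P\<close> occupy \<open>card P\<close>
  distinct cells of a bounded window, so \<open>greedy_hitting_set\<close> applies to these sets of
  cells. Rounding \<open>y\<close> to a corner costs \<open>h\<close>, and so does rounding the
  difference to the corner of its cell; hence \<open>2 * h\<close>.\<close>

lemma grid_hitting_set:
  fixes \<Phi> :: "(real^'n \<Rightarrow> real^'n) set"
  assumes h: "0 < h" "h \<le> 1"
    and fin: "finite \<Phi>" "\<Phi> \<noteq> {}" "finite P" "P \<noteq> {}"
    and sep: "\<forall>f\<in>\<Phi>. \<forall>x\<in>P. \<forall>y\<in>P. x \<noteq> y \<longrightarrow> h < infnorm (f x - f y)"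
    and bnd: "\<forall>f\<in>\<Phi>. \<forall>x\<in>P. infnorm (f x) \<le> L"
    and K: "K = 2 * L + 7"
  shows "\<exists>S. finite S \<and>
    real (card S) \<le> (K / h) ^ CARD('n) / real (card P) * ln (real (card \<Phi>) * (K / h) ^ CARD('n)) + 1 \<and>
    (\<forall>f\<in>\<Phi>. \<forall>y\<in>unit_cube. \<exists>x\<in>P. \<exists>k\<in>S. infnorm (y - f x - grid_point h k) \<le> 2 * h)"
proof -
  obtain f0 x0 where "f0 \<in> \<Phi>" "x0 \<in> P" using fin by auto
  then have L: "0 \<le> L" using bnd infnorm_pos_le[of "f0 x0"] order_trans by blast
  \<comment> \<open>Corners of cells meeting the unit cube have sup norm at most 2, so the
    differences have sup norm at most \<open>L + 2\<close>, and the floor adds at most 1. As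
    \<open>h \<le> 1\<close>, this gives \<open>2 * t + 1 \<le> (2 * L + 7) / h\<close>, the source
    of \<open>K\<close>.\<close>
  define t where "t = (L + 2) / h + 1"
  define G :: "(int^'n) set" where "G = {k. \<forall>i. \<bar>real_of_int (k $ i)\<bar> \<le> t}"
  define Y :: "(int^'n) set" where "Y = grid_cell h ` unit_cube"
  define X where "X f k = (\<lambda>x. grid_cell h (grid_point h k - f x)) ` P" for f and k :: "int^'n"
  define T where "T = (\<lambda>(f, k). X f k) ` (\<Phi> \<times> Y)"
  have t: "0 \<le> t" using L h by (simp add: t_def)
  have finG: "finite G" unfolding G_def by (rule finite_int_box)
  have "2 * t + 1 \<le> K / h" using h by (simp add: t_def K field_simps)
  then have cardG: "real (card G) \<le> (K / h) ^ CARD('n)"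
    unfolding G_def using t by (intro order_trans[OF card_int_box_le] power_mono) auto
  \<comment> \<open>The inclusion bounds the number of discretised \<open>y\<close> by the size of
    the window.\<close>
  have "Y \<subseteq> G"
  proof
    fix k assume "k \<in> Y"
    then obtain y where y: "y \<in> unit_cube" "k = grid_cell h y" by (auto simp: Y_def)
    have "1 / h + 1 \<le> t" unfolding t_def using L h by (simp add: divide_right_mono)
    then show "k \<in> G"
      using abs_grid_cell_nth_le[OF h(1) infnorm_le_1_unit_cube[OF y(1)]] y(2) order_trans
      unfolding G_def by blast
  qed
  then have finY: "finite Y" and cardY: "card Y \<le> card G"
    using finG finite_subset card_mono by blast+
  have Y0: "Y \<noteq> {}" using zero_in_unit_cube by (auto simp: Y_def)
  have T: "finite T" "T \<noteq> {}" using fin finY Y0 by (auto simp: T_def)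
  have "card T \<le> card \<Phi> * card Y"
    unfolding T_def using card_image_le[of "\<Phi> \<times> Y"] fin finY by (simp add: card_cartesian_product)
  then have "real (card T) \<le> real (card \<Phi>) * real (card Y)"
    by (metis of_nat_le_iff of_nat_mult)
  also have "\<dots> \<le> real (card \<Phi>) * (K / h) ^ CARD('n)"
    using cardY cardG by (intro mult_left_mono) auto
  finally have cardT: "real (card T) \<le> real (card \<Phi>) * (K / h) ^ CARD('n)" .
  have XG: "X f k \<subseteq> G \<and> card P \<le> card (X f k)" if f: "f \<in> \<Phi>" and k: "k \<in> Y" for f k
  proof
    obtain y where y: "y \<in> unit_cube" "k = grid_cell h y" using k by (auto simp: Y_def)
    have "infnorm (grid_point h k) \<le> infnorm y + infnorm (y - grid_point h k)"
      using infnorm_triangle[of y "grid_point h k - y"] by (simp add: infnorm_sub)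
    also have "\<dots> \<le> 1 + 1"
      using infnorm_grid_point_cell[OF h(1), of y] h y infnorm_le_1_unit_cube by (intro add_mono) auto
    finally have gk: "infnorm (grid_point h k) \<le> 2" by simp
    show "X f k \<subseteq> G"
    proof
      fix c assume "c \<in> X f k"
      then obtain x where x: "x \<in> P" "c = grid_cell h (grid_point h k - f x)" by (auto simp: X_def)
      have "infnorm (grid_point h k - f x) \<le> L + 2"
        using infnorm_triangle[of "grid_point h k" "- f x"] gk bspec[OF bspec[OF bnd f] x(1)]
        by (simp add: infnorm_neg)
      then show "c \<in> G"
        using abs_grid_cell_nth_le[OF h(1)] x(2) unfolding G_def t_def by blast
    qed
    \<comment> \<open>Two points in one cell differ by at most \<open>h\<close>, whereas the images
      under \<open>f\<close> of distinct points of \<open>P\<close> differ by more.\<close>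
    have "inj_on (\<lambda>x. grid_cell h (grid_point h k - f x)) P"
    proof (rule inj_onI, rule ccontr)
      fix x x' assume *: "x \<in> P" "x' \<in> P" "x \<noteq> x'"
        "grid_cell h (grid_point h k - f x) = grid_cell h (grid_point h k - f x')"
      have "infnorm (f x - f x') = infnorm ((grid_point h k - f x) - (grid_point h k - f x'))"
        by (simp add: infnorm_sub)
      also have "\<dots> \<le> h" using infnorm_same_grid_cell[OF h(1) *(4)] .
      finally show False using sep f *(1,2,3) by (meson not_le)
    qed
    then show "card P \<le> card (X f k)" by (simp add: X_def card_image)
  qed
  have P: "0 < card P" using fin by (simp add: card_gt_0_iff)
  have TG: "Z \<subseteq> G \<and> card P \<le> card Z" if "Z \<in> T" for Z
    using that XG by (auto simp: T_def)
  obtain S where S: "S \<subseteq> G" "\<forall>Z\<in>T. Z \<inter> S \<noteq> {}"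
    "real (card S) \<le> real (card G) / real (card P) * ln (real (card T)) + 1"
    using greedy_hitting_set[OF finG T P TG] by blast
  have T1: "1 \<le> real (card T)"
    using T by (simp add: Suc_leI card_gt_0_iff)
  have "real (card G) / real (card P) * ln (real (card T))
      \<le> (K / h) ^ CARD('n) / real (card P) * ln (real (card \<Phi>) * (K / h) ^ CARD('n))"
    using cardG cardT T1 L h K by (intro mult_mono divide_right_mono) auto
  moreover have "\<exists>x\<in>P. \<exists>k\<in>S. infnorm (y - f x - grid_point h k) \<le> 2 * h"
    if f: "f \<in> \<Phi>" and y: "y \<in> unit_cube" for f y
  proof -
    let ?y = "grid_point h (grid_cell h y)"
    have "X f (grid_cell h y) \<in> T" using f y by (auto simp: T_def Y_def)
    then obtain x where x: "x \<in> P" "grid_cell h (?y - f x) \<in> S"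
      using bspec[OF S(2)] by (fastforce simp: X_def)
    let ?g = "grid_point h (grid_cell h (?y - f x))"
    have "infnorm (y - f x - ?g) \<le> infnorm (y - ?y) + infnorm (?y - f x - ?g)"
      using infnorm_triangle[of "y - ?y" "?y - f x - ?g"] by (simp add: algebra_simps)
    also have "\<dots> \<le> h + h"
      by (intro add_mono infnorm_grid_point_cell h)
    finally show ?thesis using x by auto
  qed
  ultimately show ?thesis
    using S(1,3) finite_subset[OF S(1) finG] by (intro exI[of _ S]) auto
qed

section \<open>Volume of unions of cubes and comparison of norms\<close>

lemma measure_Union_cubes_le:
  fixes c :: "'k \<Rightarrow> real^'n"
  assumes "finite S" "0 \<le> r"
  shows "measure lborel (\<Union>k\<in>S. cbox (c k - r *\<^sub>R One) (c k + r *\<^sub>R One))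
    \<le> real (card S) * (2 * r) ^ CARD('n)"
proof -
  have "measure lborel (cbox (c k - r *\<^sub>R One) (c k + r *\<^sub>R One)) = (2 * r) ^ CARD('n)" for k
  proof -
    have "c k \<in> cbox (c k - r *\<^sub>R One) (c k + r *\<^sub>R One)"
      using assms(2) by (simp add: mem_box_cart)
    then have "cbox (c k - r *\<^sub>R One) (c k + r *\<^sub>R One) \<noteq> {}" by blast
    then show ?thesis by (subst content_cbox_cart) auto
  qed
  then show ?thesis
    using measure_UNION_le[of S "\<lambda>k. cbox (c k - r *\<^sub>R One) (c k + r *\<^sub>R One)" lborel] assms(1)
    by simp
qed

lemma mem_cbox_infnorm_iff:
  fixes z :: "real^'n"
  shows "z \<in> cbox (c - r *\<^sub>R One) (c + r *\<^sub>R One) \<longleftrightarrow> infnorm (z - c) \<le> r"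
  by (simp add: mem_box_cart infnorm_le_cart_iff abs_le_iff) (smt (verit))

lemma norm_le_sqrt_infnorm: "norm (x :: real^'n) \<le> sqrt (real CARD('n)) * infnorm x"
  using norm_le_infnorm[of x] by simp

lemma Inf_enat_mem: "(A :: enat set) \<noteq> {} \<Longrightarrow> Inf A \<in> A"
  unfolding Inf_enat_def by (auto intro: LeastI)

section \<open>Finite nets and uniform bounds for a bilipschitz family\<close>

locale bilipschitz_family =
  fixes C :: real and F :: "((real^'n) \<Rightarrow> (real^'n)) set"
  assumes C_ge: "C \<ge> 1"
    and bilip: "\<forall>f\<in>F. \<forall>x\<in>unit_cube. \<forall>y\<in>unit_cube.
                  infnorm (x - y) / C \<le> infnorm (f x - f y) \<and>
                  infnorm (f x - f y) \<le> infnorm (x - y)"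
begin

lemma infnorm_image_le:
  "f \<in> F \<Longrightarrow> x \<in> unit_cube \<Longrightarrow> y \<in> unit_cube \<Longrightarrow> infnorm (f x - f y) \<le> infnorm (x - y)"
  using bilip by blast

lemma infnorm_image_ge:
  "f \<in> F \<Longrightarrow> x \<in> unit_cube \<Longrightarrow> y \<in> unit_cube \<Longrightarrow> infnorm (x - y) / C \<le> infnorm (f x - f y)"
  using bilip by blast

lemma infnorm_image_diff_0_le:
  assumes "f \<in> F" "x \<in> unit_cube"
  shows "infnorm (f x - f 0) \<le> 1"
  using infnorm_image_le[OF assms zero_in_unit_cube] infnorm_le_1_unit_cube[OF assms(2)] by simp

text \<open>A real supremum is known to bound its terms only for a set bounded above. Boundedness
  comes from the path \<open>f z\<close>, \<open>f 0\<close>, \<open>g 0\<close>,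
  \<open>g z\<close>, whose two outer steps have length at most 1 by the Lipschitz bound.\<close>

lemma infnorm_diff_le_SUP:
  assumes "f \<in> F" "g \<in> F" "x \<in> unit_cube"
  shows "infnorm (f x - g x) \<le> (SUP x\<in>unit_cube. infnorm (f x - g x))"
proof (rule cSUP_upper[OF assms(3)])
  have "infnorm (f z - g z) \<le> 1 + (infnorm (f 0 - g 0) + 1)" if "z \<in> unit_cube" for z
    using infnorm_image_diff_0_le[OF assms(1) that] infnorm_image_diff_0_le[OF assms(2) that]
      infnorm_triangle_sub[of "f z" "g z" "f 0"] infnorm_triangle_sub[of "f 0" "g z" "g 0"]
      infnorm_sub[of "g z" "g 0"]
    by linarith
  then show "bdd_above ((\<lambda>x. infnorm (f x - g x)) ` unit_cube)"
    by (intro bdd_aboveI2)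
qed

text \<open>Infima of nonempty sets in \<open>enat\<close> are attained, and the empty set has
  infimum \<infinity>, which the bound \<open>enat m\<close> excludes. The supremum in
  \<open>fun_cover_num\<close> then turns into a pointwise bound.\<close>

lemma finite_net:
  assumes "fun_cover_num F \<delta> \<le> enat m"
  obtains \<Phi> where "finite \<Phi>" "\<Phi> \<subseteq> F" "card \<Phi> \<le> m"
    "\<And>f. f \<in> F \<Longrightarrow> \<exists>g\<in>\<Phi>. \<forall>x\<in>unit_cube. infnorm (f x - g x) \<le> \<delta>"
proof -
  let ?A = "{enat (card S) | S. finite S \<and> S \<subseteq> F \<and>
          (\<forall>f\<in>F. \<exists>g\<in>S. (SUP x\<in>unit_cube. infnorm (f x - g x)) \<le> \<delta>)}"
  have "?A \<noteq> {}"
  proof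
    assume "?A = {}"
    then have "fun_cover_num F \<delta> = \<infinity>" unfolding fun_cover_num_def by (simp only:) (simp add: Inf_enat_def)
    then show False using assms by simp
  qed
  then have "Inf ?A \<in> ?A" by (rule Inf_enat_mem)
  then obtain S where S: "Inf ?A = enat (card S)" "finite S" "S \<subseteq> F"
    "\<forall>f\<in>F. \<exists>g\<in>S. (SUP x\<in>unit_cube. infnorm (f x - g x)) \<le> \<delta>"
    by blast
  have "card S \<le> m" using assms S(1) unfolding fun_cover_num_def by simp
  moreover have "\<exists>g\<in>S. \<forall>x\<in>unit_cube. infnorm (f x - g x) \<le> \<delta>" if f: "f \<in> F" for f
  proof -
    obtain g where g: "g \<in> S" "(SUP x\<in>unit_cube. infnorm (f x - g x)) \<le> \<delta>"
      using S(4) f by blast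
    then have gF: "g \<in> F" using S(3) by blast
    have "infnorm (f x - g x) \<le> \<delta>" if "x \<in> unit_cube" for x
      using infnorm_diff_le_SUP[OF f gF that] g(2) by (rule order_trans)
    then show ?thesis using g(1) by blast
  qed
  ultimately show thesis using S(2,3) by (intro that)
qed

text \<open>The Lipschitz bound controls only the oscillation of each function; the finite net
  controls the values at 0.\<close>

lemma uniformly_bounded:
  assumes "fun_cover_num F \<delta> \<le> enat m"
  shows "\<exists>L. \<forall>f\<in>F. \<forall>x\<in>unit_cube. infnorm (f x) \<le> L"
proof -
  obtain \<Phi> where \<Phi>: "finite \<Phi>" "\<Phi> \<subseteq> F"
    "\<And>f. f \<in> F \<Longrightarrow> \<exists>g\<in>\<Phi>. \<forall>x\<in>unit_cube. infnorm (f x - g x) \<le> \<delta>"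
    by (rule finite_net[OF assms]) blast
  \<comment> \<open>The sum majorises each \<open>infnorm (g 0)\<close> and, unlike a maximum, makes
    sense for an empty net.\<close>
  have "infnorm (f x) \<le> \<delta> + (1 + (\<Sum>g\<in>\<Phi>. infnorm (g 0)))"
    if f: "f \<in> F" and x: "x \<in> unit_cube" for f x
  proof -
    obtain g where g: "g \<in> \<Phi>" "infnorm (f x - g x) \<le> \<delta>" using \<Phi>(3)[OF f] x by blast
    have "infnorm (g 0) \<le> (\<Sum>g\<in>\<Phi>. infnorm (g 0))"
      using \<Phi>(1) g(1) by (intro member_le_sum) (auto simp: infnorm_pos_le)
    moreover have "infnorm (f x) \<le> infnorm (f x - g x) + infnorm (g x)"
      "infnorm (g x) \<le> infnorm (g x - g 0) + infnorm (g 0)"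
      using infnorm_triangle[of "f x - g x" "g x"] infnorm_triangle[of "g x - g 0" "g 0"] by simp_all
    moreover have "infnorm (g x - g 0) \<le> 1"
      using infnorm_image_diff_0_le g(1) \<Phi>(2) x by blast
    ultimately show ?thesis using g(2) by linarith
  qed
  then show ?thesis by blast
qed

section \<open>Hitting sets with a margin, at a single scale\<close>

text \<open>The margin \<open>r\<close> leaves room to replace \<open>x\<close> later by a nearby
  point while \<open>y - f x\<close> stays in \<open>B\<close>.\<close>

definition margin_hits :: "real \<Rightarrow> (real^'n) set \<Rightarrow> (real^'n) set \<Rightarrow> bool" where
  "margin_hits r E B \<longleftrightarrow>
     (\<forall>f\<in>F. \<forall>y\<in>unit_cube. \<exists>x\<in>E. \<forall>z. infnorm (z - (y - f x)) \<le> r \<longrightarrow> z \<in> B)"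

text \<open>The grid argument is applied to a finite \<delta>-net of \<open>F\<close> and to
  \<open>n\<close> points of \<open>E\<close> separated by \<open>C * \<delta>\<close>;
  \<open>R\<close> is a union of cubes about the chosen grid points. In the measure bound the powers
  of \<delta> cancel in the main factor, so that \<delta> survives only in the logarithm and in the
  last term.\<close>

lemma hitting_set_at_scale:
  assumes E: "E \<subseteq> unit_cube" and F0: "F \<noteq> {}"
    and L: "\<forall>f\<in>F. \<forall>x\<in>unit_cube. infnorm (f x) \<le> L" and K: "K = 2 * L + 7"
    and \<delta>: "0 < \<delta>" "\<delta> \<le> 1" and m: "fun_cover_num F \<delta> \<le> enat m"
    and n: "0 < n" "n \<le> ball_cover_num E (C * \<delta>)"
  shows "\<exists>R. compact R \<and> margin_hits \<delta> E R \<and>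
    measure lborel R \<le> (8 * sqrt (real CARD('n)) * K) ^ CARD('n) / real n *
        ln (real m * (K * sqrt (real CARD('n)) / \<delta>) ^ CARD('n)) + (8 * \<delta>) ^ CARD('n)"
proof -
  define s where "s = sqrt (real CARD('n))"
  \<comment> \<open>The separation is Euclidean: passing to the sup norm costs a factor
    \<open>s\<close>, and the lower Lipschitz bound a factor \<open>C\<close>, so points more than
    \<open>C * \<delta>\<close> apart have images more than \<open>\<delta> / s\<close> apart in the
    sup norm.\<close>
  define h where "h = \<delta> / s"
  have s: "1 \<le> s" by (simp add: s_def Suc_leI)
  have h: "0 < h" "h \<le> \<delta>" using \<delta> s by (simp_all add: h_def field_simps)
  have h1: "h \<le> 1" using h(2) \<delta>(2) by (rule order_trans)
  have Kh: "K / h = K * s / \<delta>" by (simp add: h_def)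
  obtain f0 where "f0 \<in> F" using F0 by blast
  then have L0: "0 \<le> L" using L zero_in_unit_cube infnorm_pos_le order_trans by blast
  have "K * s \<ge> 1 * 1" using L0 K s by (intro mult_mono) auto
  then have Ks: "1 \<le> K * s / \<delta>" using \<delta> by (simp add: field_simps)
  obtain \<Phi> where \<Phi>: "finite \<Phi>" "\<Phi> \<subseteq> F" "card \<Phi> \<le> m"
    "\<And>f. f \<in> F \<Longrightarrow> \<exists>g\<in>\<Phi>. \<forall>x\<in>unit_cube. infnorm (f x - g x) \<le> \<delta>"
    by (rule finite_net[OF m]) blast
  have \<Phi>0: "\<Phi> \<noteq> {}" using \<Phi>(4) \<open>f0 \<in> F\<close> by blast
  obtain P where P: "finite P" "card P = n" "P \<subseteq> E"
    "\<forall>x\<in>P. \<forall>y\<in>P. x \<noteq> y \<longrightarrow> C * \<delta> < dist x y"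
    using separated_subset_of_ball_cover_num[OF _ n(2)] \<delta> C_ge by auto
  have P0: "P \<noteq> {}" using P(2) n(1) by auto
  have sep: "\<forall>f\<in>\<Phi>. \<forall>x\<in>P. \<forall>y\<in>P. x \<noteq> y \<longrightarrow> h < infnorm (f x - f y)"
  proof (intro ballI impI)
    fix f x y assume that: "f \<in> \<Phi>" "x \<in> P" "y \<in> P" "x \<noteq> y"
    have "C * \<delta> < norm (x - y)" using P(4) that by (simp add: dist_norm)
    also have "\<dots> \<le> s * infnorm (x - y)" unfolding s_def by (rule norm_le_sqrt_infnorm)
    finally have "h < infnorm (x - y) / C" using C_ge s by (simp add: h_def field_simps)
    also have "\<dots> \<le> infnorm (f x - f y)"
      using infnorm_image_ge that \<Phi>(2) P(3) E by blast
    finally show "h < infnorm (f x - f y)" .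
  qed
  have bnd: "\<forall>f\<in>\<Phi>. \<forall>x\<in>P. infnorm (f x) \<le> L"
    using L \<Phi>(2) P(3) E by blast
  obtain S where S: "finite S"
    "real (card S) \<le> (K / h) ^ CARD('n) / real (card P) * ln (real (card \<Phi>) * (K / h) ^ CARD('n)) + 1"
    "\<forall>f\<in>\<Phi>. \<forall>y\<in>unit_cube. \<exists>x\<in>P. \<exists>k\<in>S. infnorm (y - f x - grid_point h k) \<le> 2 * h"
    using grid_hitting_set[OF h(1) h1 \<Phi>(1) \<Phi>0 P(1) P0 sep bnd K] by blast
  \<comment> \<open>The radius \<open>4 * \<delta>\<close> adds up the margin \<delta>, the net
    error \<delta> and the grid error \<open>2 * h \<le> 2 * \<delta>\<close>.\<close>
  define R where "R = (\<Union>k\<in>S. cbox (grid_point h k - (4 * \<delta>) *\<^sub>R One) (grid_point h k + (4 * \<delta>) *\<^sub>R One))"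
  have "compact R" unfolding R_def using S(1) by (intro compact_UN) auto
  moreover have "margin_hits \<delta> E R"
    unfolding margin_hits_def
  proof (intro ballI)
    fix f and y :: "real^'n" assume f: "f \<in> F" and y: "y \<in> unit_cube"
    obtain g where g: "g \<in> \<Phi>" "\<forall>x\<in>unit_cube. infnorm (f x - g x) \<le> \<delta>" using \<Phi>(4)[OF f] by blast
    obtain x k where xk: "x \<in> P" "k \<in> S" "infnorm (y - g x - grid_point h k) \<le> 2 * h"
      using S(3) g(1) y by blast
    have fg: "infnorm (f x - g x) \<le> \<delta>" using g(2) xk(1) P(3) E by blast
    have "z \<in> R" if z: "infnorm (z - (y - f x)) \<le> \<delta>" for z
    proof -
      have "infnorm (z - grid_point h k) \<le> infnorm (z - (y - f x)) + infnorm (y - f x - grid_point h k)"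
        by (rule infnorm_triangle_sub)
      moreover have "infnorm (y - f x - grid_point h k) \<le> infnorm (f x - g x) + infnorm (y - g x - grid_point h k)"
        using infnorm_triangle_sub[of "y - f x" "grid_point h k" "y - g x"]
        by (simp add: infnorm_sub[of "g x" "f x"])
      ultimately have "infnorm (z - grid_point h k) \<le> 4 * \<delta>"
        using z fg xk(3) h(2) by linarith
      then show ?thesis unfolding R_def using xk(2) mem_cbox_infnorm_iff by blast
    qed
    then show "\<exists>x\<in>E. \<forall>z. infnorm (z - (y - f x)) \<le> \<delta> \<longrightarrow> z \<in> R"
      using xk(1) P(3) by blast
  qed
  moreover have "measure lborel R \<le> (8 * s * K) ^ CARD('n) / real n *
        ln (real m * (K * s / \<delta>) ^ CARD('n)) + (8 * \<delta>) ^ CARD('n)"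
  proof -
    have c: "1 \<le> real (card \<Phi>)" using \<Phi>(1) \<Phi>0 by (simp add: Suc_leI card_gt_0_iff)
    have p: "1 \<le> (K * s / \<delta>) ^ CARD('n)" using Ks by (rule one_le_power)
    have "1 * 1 \<le> real (card \<Phi>) * (K * s / \<delta>) ^ CARD('n)"
      using c p by (intro mult_mono) auto
    moreover have "real (card \<Phi>) * (K * s / \<delta>) ^ CARD('n) \<le> real m * (K * s / \<delta>) ^ CARD('n)"
      using \<Phi>(3) p by (intro mult_right_mono) auto
    ultimately have ln_le: "ln (real (card \<Phi>) * (K * s / \<delta>) ^ CARD('n)) \<le> ln (real m * (K * s / \<delta>) ^ CARD('n))"
      by simp
    have "measure lborel R \<le> real (card S) * (2 * (4 * \<delta>)) ^ CARD('n)"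
      unfolding R_def using \<delta> S(1) by (intro measure_Union_cubes_le) auto
    also have "\<dots> \<le> ((K / h) ^ CARD('n) / real n * ln (real m * (K * s / \<delta>) ^ CARD('n)) + 1) * (8 * \<delta>) ^ CARD('n)"
    proof (intro mult_mono)
      have "(K / h) ^ CARD('n) / real n * ln (real (card \<Phi>) * (K / h) ^ CARD('n))
          \<le> (K / h) ^ CARD('n) / real n * ln (real m * (K * s / \<delta>) ^ CARD('n))"
        using ln_le p unfolding Kh by (intro mult_left_mono) auto
      then show "real (card S) \<le> (K / h) ^ CARD('n) / real n * ln (real m * (K * s / \<delta>) ^ CARD('n)) + 1"
        using S(2) P(2) by simp
      then show "0 \<le> (K / h) ^ CARD('n) / real n * ln (real m * (K * s / \<delta>) ^ CARD('n)) + 1"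
        using of_nat_0_le_iff order_trans by blast
    qed (use \<delta> in auto)
    also have "\<dots> = (K / h * (8 * \<delta>)) ^ CARD('n) / real n * ln (real m * (K * s / \<delta>) ^ CARD('n)) + (8 * \<delta>) ^ CARD('n)"
      unfolding power_mult_distrib[of "K / h" "8 * \<delta>"] by (simp add: distrib_right)
    also have "K / h * (8 * \<delta>) = 8 * s * K" using \<delta> s by (simp add: h_def)
    finally show ?thesis .
  qed
  ultimately show ?thesis unfolding s_def by blast
qed

text \<open>A net of a nonempty family has a member. This keeps
  \<open>ln (M \<delta> / \<delta>)\<close> at least \<open>ln (1 / \<delta>)\<close>.\<close>

lemma cover_bound_pos:
  assumes "F \<noteq> {}" "fun_cover_num F \<delta> \<le> enat m"
  shows "0 < m"
proof (rule finite_net[OF assms(2)])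
  fix \<Phi> assume "finite \<Phi>" "card \<Phi> \<le> m"
    "\<And>f. f \<in> F \<Longrightarrow> \<exists>g\<in>\<Phi>. \<forall>x\<in>unit_cube. infnorm (f x - g x) \<le> \<delta>"
  then show "0 < m" using assms(1) by (cases "m = 0") auto
qed

text \<open>The limsup provides arbitrarily small scales at which the covering number of
  \<open>E\<close> exceeds half of \<open>N\<close>; dividing such a scale by \<open>C\<close> gives
  \<delta>. There \<open>n\<close> exceeds \<open>W * l / 2\<close> with
  \<open>l = ln (M \<delta> / \<delta>)\<close>, while the logarithm in
  \<open>hitting_set_at_scale\<close> is at most \<open>(2 * d + 1) * l\<close>, so the main term is
  at most \<open>\<epsilon> / 2\<close>.\<close>

lemma small_hitting_set:
  fixes N M :: "real \<Rightarrow> nat"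
  assumes E: "E \<subseteq> unit_cube" and F0: "F \<noteq> {}"
    and L: "\<forall>f\<in>F. \<forall>x\<in>unit_cube. infnorm (f x) \<le> L"
    and NM_lim: "filterlim (\<lambda>\<delta>. real (N (C * \<delta>)) / ln (real (M \<delta>) / \<delta>)) at_top (at_right 0)"
    and cover: "\<forall>\<^sub>F \<delta> in at_right 0. fun_cover_num F \<delta> \<le> enat (M \<delta>)"
    and large: "Limsup (at_right 0) (\<lambda>\<delta>. ereal (real (ball_cover_num E \<delta>) / real (N \<delta>))) \<ge> 1"
    and \<epsilon>: "0 < \<epsilon>"
  shows "\<exists>R r. compact R \<and> 0 < r \<and> margin_hits r E R \<and> measure lborel R \<le> \<epsilon>"
proof -
  define d where "d = CARD('n)"
  define s where "s = sqrt (real d)"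
  define K where "K = 2 * L + 7"
  define A where "A = (8 * s * K) ^ d"
  \<comment> \<open>Chosen so that \<open>(A + 1) * (2 * d + 1) = \<epsilon> / 2 * (W / 2)\<close>;
    taking \<open>A + 1\<close> in place of \<open>A\<close> ensures \<open>0 < W\<close>.\<close>
  define W where "W = 4 * (2 * real d + 1) * (A + 1) / \<epsilon>"
  \<comment> \<open>The first bound makes \<open>K * s / \<delta>\<close> at most the square of
    \<open>1 / \<delta>\<close>; the second gives
    \<open>(8 * \<delta>) ^ d \<le> 8 * \<delta>\<close>, and the third makes this at most
    \<open>\<epsilon> / 2\<close>.\<close>
  define \<delta>\<^sub>1 where "\<delta>\<^sub>1 = min (1 / (K * s)) (min (1 / 8) (\<epsilon> / 16))"
  have d: "1 \<le> d" by (simp add: d_def Suc_leI)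
  have s: "1 \<le> s" using d by (simp add: s_def)
  obtain f0 where "f0 \<in> F" using F0 by blast
  then have L0: "0 \<le> L" using L zero_in_unit_cube infnorm_pos_le[of "f0 0"] order_trans by blast
  have "1 * 1 \<le> K * s" using L0 K_def s by (intro mult_mono) auto
  then have Ks: "0 < K * s" by simp
  have A: "0 \<le> A" using s L0 by (simp add: A_def K_def)
  have W: "0 < W" using A \<epsilon> by (simp add: W_def)
  have \<delta>\<^sub>1: "0 < \<delta>\<^sub>1" using Ks \<epsilon> by (simp add: \<delta>\<^sub>1_def)
  have "\<forall>\<^sub>F \<delta> in at_right 0. W \<le> real (N (C * \<delta>)) / ln (real (M \<delta>) / \<delta>) \<and>
      fun_cover_num F \<delta> \<le> enat (M \<delta>) \<and> \<delta> \<in> {0<..<\<delta>\<^sub>1}"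
    using NM_lim cover eventually_at_right_real[OF \<delta>\<^sub>1]
    unfolding filterlim_at_top by (intro eventually_conj) auto
  then obtain b where b: "0 < b"
    "\<And>\<delta>. 0 < \<delta> \<Longrightarrow> \<delta> < b \<Longrightarrow> W \<le> real (N (C * \<delta>)) / ln (real (M \<delta>) / \<delta>) \<and>
      fun_cover_num F \<delta> \<le> enat (M \<delta>) \<and> \<delta> \<in> {0<..<\<delta>\<^sub>1}"
    unfolding eventually_at_right_field by blast
  \<comment> \<open>A limsup of at least 1 rules out an eventual bound 1/2, so the quotient exceeds
    1/2 at arbitrarily small scales.\<close>
  have "\<not> (\<forall>\<^sub>F \<delta> in at_right 0. ereal (real (ball_cover_num E \<delta>) / real (N \<delta>)) \<le> ereal (1 / 2))"
  proof
    assume "\<forall>\<^sub>F \<delta> in at_right 0. ereal (real (ball_cover_num E \<delta>) / real (N \<delta>)) \<le> ereal (1 / 2)"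
    then have "Limsup (at_right 0) (\<lambda>\<delta>. ereal (real (ball_cover_num E \<delta>) / real (N \<delta>))) \<le> ereal (1 / 2)"
      by (rule Limsup_bounded)
    then have "(1 :: ereal) \<le> ereal (1 / 2)" using large by (rule order_trans[rotated])
    then show False by (simp add: one_ereal_def)
  qed
  then have "\<exists>\<^sub>F \<delta> in at_right 0. real (ball_cover_num E \<delta>) / real (N \<delta>) > 1 / 2"
    by (simp add: frequently_def not_less)
  moreover have "\<forall>\<^sub>F \<delta> in at_right 0. \<delta> \<in> {0<..<C * b}"
    using C_ge b(1) by (intro eventually_at_right_real) simp
  ultimately obtain \<delta>' where \<delta>': "real (ball_cover_num E \<delta>') / real (N \<delta>') > 1 / 2" "0 < \<delta>'" "\<delta>' < C * b"
    using frequently_eventually_frequently frequently_ex by (smt (verit) greaterThanLessThan_iff)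
  define \<delta> where "\<delta> = \<delta>' / C"
  define m where "m = M \<delta>"
  define n where "n = ball_cover_num E (C * \<delta>)"
  define l where "l = ln (real m / \<delta>)"
  have C\<delta>: "C * \<delta> = \<delta>'" using C_ge by (simp add: \<delta>_def)
  have \<delta>: "0 < \<delta>" "\<delta> < b" using \<delta>' C_ge by (simp_all add: \<delta>_def field_simps)
  have NW: "W \<le> real (N (C * \<delta>)) / l" and m: "fun_cover_num F \<delta> \<le> enat m" and \<delta>1: "\<delta> < \<delta>\<^sub>1"
    using b(2)[OF \<delta>] by (auto simp: m_def l_def)
  have \<delta>18: "\<delta> \<le> 1" "8 * \<delta> \<le> 1" "8 * \<delta> \<le> \<epsilon> / 2" and "\<delta> \<le> 1 / (K * s)"
    using \<delta>1 by (auto simp: \<delta>\<^sub>1_def)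
  then have Ks\<delta>: "K * s \<le> 1 / \<delta>" using Ks \<delta> by (simp add: field_simps)
  have m1: "1 \<le> real m" using cover_bound_pos[OF F0 m] by simp
  have "1 / \<delta> \<le> real m / \<delta>" using m1 \<delta> by (simp add: divide_right_mono)
  then have ln\<delta>: "ln (1 / \<delta>) \<le> l" unfolding l_def using \<delta> by (intro ln_mono) auto
  have "real m * 1 \<le> real m * (1 / \<delta>)" using \<delta> \<delta>18 by (intro mult_left_mono) auto
  then have lnm: "ln (real m) \<le> l" unfolding l_def using m1 by (intro ln_mono) auto
  have "0 < ln (1 / \<delta>)" using \<delta> \<delta>18 by (intro ln_gt_zero) (simp add: field_simps)
  then have l: "0 < l" using ln\<delta> by simp
  have "W * l \<le> real (N (C * \<delta>))" using NW l by (simp add: pos_le_divide_eq)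
  moreover have "real (N (C * \<delta>)) < 2 * real n"
  proof -
    \<comment> \<open>Division by zero yields 0, so a quotient above 1/2 excludes
      \<open>N \<delta>' = 0\<close>.\<close>
    have "0 < real (N \<delta>')" using \<delta>'(1) by (cases "N \<delta>' = 0") auto
    then show ?thesis using \<delta>'(1) unfolding n_def C\<delta> by (simp add: field_simps)
  qed
  ultimately have n: "W * l / 2 < real n" by simp
  moreover have "0 < W * l" using W l by simp
  ultimately have n0: "0 < real n" by linarith
  have Ks2: "0 < K * s / \<delta>" using Ks \<delta> by simp
  have "ln (real m * q ^ d) = ln (real m) + real d * ln q" if "0 < q" for q
    using m1 that by (simp add: ln_mult ln_realpow)
  from this[OF Ks2] have "ln (real m * (K * s / \<delta>) ^ d) = ln (real m) + real d * ln (K * s / \<delta>)" .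
  also have "ln (K * s / \<delta>) \<le> ln ((1 / \<delta>)\<^sup>2)"
  proof (rule ln_mono)
    have "K * s * (1 / \<delta>) \<le> 1 / \<delta> * (1 / \<delta>)" using Ks\<delta> \<delta> by (intro mult_right_mono) auto
    then show "K * s / \<delta> \<le> (1 / \<delta>)\<^sup>2" by (simp add: power2_eq_square)
  qed (use Ks2 in auto)
  also have "ln ((1 / \<delta>)\<^sup>2) = 2 * ln (1 / \<delta>)" using \<delta> by (simp add: ln_realpow)
  also have "\<dots> \<le> 2 * l" using ln\<delta> by simp
  finally have "ln (real m * (K * s / \<delta>) ^ d) \<le> ln (real m) + real d * (2 * l)"
    by (simp add: mult_left_mono)
  then have lnT: "ln (real m * (K * s / \<delta>) ^ d) \<le> (2 * real d + 1) * l"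
    using lnm by (simp add: algebra_simps)
  have "A * ln (real m * (K * s / \<delta>) ^ d) \<le> A * ((2 * real d + 1) * l)"
    using lnT A by (rule mult_left_mono)
  also have "\<dots> \<le> (A + 1) * ((2 * real d + 1) * l)"
    using l by (intro mult_right_mono) auto
  also have "\<dots> = \<epsilon> / 2 * (W * l / 2)" using \<epsilon> by (simp add: W_def)
  also have "\<dots> \<le> \<epsilon> / 2 * real n" using n \<epsilon> by (intro mult_left_mono) auto
  finally have "A / real n * ln (real m * (K * s / \<delta>) ^ d) \<le> \<epsilon> / 2"
    using n0 by (simp add: pos_divide_le_eq)
  moreover have "(8 * \<delta>) ^ d \<le> \<epsilon> / 2"
    using power_decreasing[OF d, of "8 * \<delta>"] \<delta> \<delta>18 by simp
  moreover obtain R where R: "compact R" "margin_hits \<delta> E R"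
    "measure lborel R \<le> A / real n * ln (real m * (K * s / \<delta>) ^ d) + (8 * \<delta>) ^ d"
    using hitting_set_at_scale[OF E F0 L K_def \<delta>(1) \<delta>18(1) m, of n] n0
    unfolding A_def s_def d_def n_def by auto
  ultimately have "measure lborel R \<le> \<epsilon>" by linarith
  then show ?thesis using R \<delta> by blast
qed

section \<open>Refinement and passage to the limit\<close>

text \<open>Finitely many cubes of side \<open>r / 2\<close> cover \<open>A'\<close>, each with its
  own small hitting set \<open>R c\<close>, and \<open>B'\<close> is the part of \<open>B\<close> in
  the union of these. Moving \<open>x\<close> to another point of its cube changes
  \<open>f x\<close> by at most \<open>r / 2\<close>, which uses up at most half of the margin of
  \<open>B\<close>.\<close>

lemma refine_margin_hits:
  fixes N M :: "real \<Rightarrow> nat"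
  assumes F0: "F \<noteq> {}"
    and L: "\<forall>f\<in>F. \<forall>x\<in>unit_cube. infnorm (f x) \<le> L"
    and NM_lim: "filterlim (\<lambda>\<delta>. real (N (C * \<delta>)) / ln (real (M \<delta>) / \<delta>)) at_top (at_right 0)"
    and cover: "\<forall>\<^sub>F \<delta> in at_right 0. fun_cover_num F \<delta> \<le> enat (M \<delta>)"
    and A': "compact A'" "A' \<noteq> {}" "A' \<subseteq> unit_cube"
    and large: "\<forall>Q. axis_cube Q \<and> A' \<inter> interior Q \<noteq> {} \<longrightarrow>
           Limsup (at_right 0)
             (\<lambda>\<delta>. ereal (real (ball_cover_num (A' \<inter> interior Q) \<delta>) / real (N \<delta>))) \<ge> 1"
    and B: "compact B" "0 < r" "margin_hits r A' B"
    and \<epsilon>: "0 < \<epsilon>"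
  shows "\<exists>B' r'. compact B' \<and> B' \<subseteq> B \<and> 0 < r' \<and> margin_hits r' A' B' \<and> measure lborel B' \<le> \<epsilon>"
proof -
  define Q where "Q c = cbox (c - (r / 4) *\<^sub>R One) (c + (r / 4) *\<^sub>R One)" for c :: "real^'n"
  have cube: "axis_cube (Q c)" for c
    unfolding axis_cube_def Q_def
  proof (intro exI conjI)
    show "0 < r / 2" using B(2) by simp
    have "c + (r / 4) *\<^sub>R One = c - (r / 4) *\<^sub>R One + (r / 2) *\<^sub>R One"
      by (simp add: vec_eq_iff)
    then show "cbox (c - (r / 4) *\<^sub>R One) (c + (r / 4) *\<^sub>R One) =
        cbox (c - (r / 4) *\<^sub>R One) (c - (r / 4) *\<^sub>R One + (r / 2) *\<^sub>R One)"
      by (rule arg_cong)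
  qed
  have center: "c \<in> interior (Q c)" for c
    using B(2) by (simp add: Q_def interior_cbox mem_box_cart)
  have Q_dist: "infnorm (x - c) \<le> r / 4" if "x \<in> interior (Q c)" for x c
    using that interior_subset[of "Q c"] mem_cbox_infnorm_iff unfolding Q_def by blast
  \<comment> \<open>The centres are taken in \<open>A'\<close>, so that every cube has a point of
    \<open>A'\<close> in its interior and \<open>large\<close> applies to it.\<close>
  obtain D where D: "D \<subseteq> A'" "finite D" "A' \<subseteq> (\<Union>c\<in>D. interior (Q c))"
    using compactE_image[OF A'(1), of A' "\<lambda>c. interior (Q c)"] center by blast
  have D0: "D \<noteq> {}" "0 < card D" using D A'(2) by (auto simp: card_gt_0_iff)
  have "\<exists>R r. compact R \<and> 0 < r \<and> margin_hits r (A' \<inter> interior (Q c)) R \<and> measure lborel R \<le> \<epsilon> / real (card D)"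
    if "c \<in> D" for c
  proof (rule small_hitting_set[OF _ F0 L NM_lim cover])
    show "A' \<inter> interior (Q c) \<subseteq> unit_cube" using A'(3) by blast
    show "Limsup (at_right 0)
        (\<lambda>\<delta>. ereal (real (ball_cover_num (A' \<inter> interior (Q c)) \<delta>) / real (N \<delta>))) \<ge> 1"
      using large cube center that D(1) by blast
    show "0 < \<epsilon> / real (card D)" using \<epsilon> D0 by simp
  qed
  then obtain R \<rho> where R: "\<And>c. c \<in> D \<Longrightarrow> compact (R c) \<and> 0 < \<rho> c \<and>
      margin_hits (\<rho> c) (A' \<inter> interior (Q c)) (R c) \<and> measure lborel (R c) \<le> \<epsilon> / real (card D)"
    by metis
  \<comment> \<open>\<open>r / 2\<close> is what remains of the old margin after the move; the
    minimum over \<open>D\<close> serves whichever \<open>R c\<close> is hit.\<close>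
  define r' where "r' = min (r / 2) (Min (\<rho> ` D))"
  define B' where "B' = B \<inter> (\<Union>c\<in>D. R c)"
  have r': "0 < r'" using B(2) D D0 R by (simp add: r'_def)
  have cU: "compact (\<Union>c\<in>D. R c)" using D(2) R by (intro compact_UN) auto
  then have cB': "compact B'" unfolding B'_def using B(1) by (rule compact_Int[rotated])
  have "measure lborel B' \<le> measure lborel (\<Union>c\<in>D. R c)"
    using cB' cU by (intro measure_mono_fmeasurable fmeasurable_compact)
      (auto simp: B'_def borel_compact)
  also have "\<dots> \<le> (\<Sum>c\<in>D. measure lborel (R c))"
    using D(2) R by (intro measure_UNION_le) (auto simp: borel_compact)
  also have "\<dots> \<le> (\<Sum>c\<in>D. \<epsilon> / real (card D))"
    using R by (intro sum_mono) blast
  also have "\<dots> = \<epsilon>" using D0 by simp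
  finally have mB': "measure lborel B' \<le> \<epsilon>" .
  have "margin_hits r' A' B'"
    unfolding margin_hits_def
  proof (intro ballI)
    fix f and y :: "real^'n" assume f: "f \<in> F" and y: "y \<in> unit_cube"
    \<comment> \<open>The old point \<open>x\<close> serves to select the cube \<open>Q c\<close>;
      the point \<open>x'\<close> that keeps the new margin comes from the hitting set of that
      cube.\<close>
    obtain x where x: "x \<in> A'" "\<And>z. infnorm (z - (y - f x)) \<le> r \<Longrightarrow> z \<in> B"
      using B(3) f y unfolding margin_hits_def by blast
    obtain c where c: "c \<in> D" "x \<in> interior (Q c)" using D(3) x(1) by blast
    have "margin_hits (\<rho> c) (A' \<inter> interior (Q c)) (R c)" using R[OF c(1)] by blast
    then obtain x' where x': "x' \<in> A'" "x' \<in> interior (Q c)"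
      "\<And>z. infnorm (z - (y - f x')) \<le> \<rho> c \<Longrightarrow> z \<in> R c"
      using f y unfolding margin_hits_def by blast
    have "infnorm (f x - f x') \<le> infnorm (x - x')"
      using infnorm_image_le[OF f] x(1) x'(1) A'(3) by blast
    also have "\<dots> \<le> infnorm (x - c) + infnorm (c - x')" by (rule infnorm_triangle_sub)
    also have "\<dots> \<le> r / 4 + r / 4"
      using Q_dist[OF c(2)] Q_dist[OF x'(2)] by (intro add_mono) (simp_all add: infnorm_sub)
    finally have ff: "infnorm (f x - f x') \<le> r / 2" by simp
    have r'c: "r' \<le> r / 2" "r' \<le> \<rho> c"
      using D(2) c(1) by (auto simp: r'_def min_le_iff_disj)
    have "z \<in> B'" if z: "infnorm (z - (y - f x')) \<le> r'" for z
    proof -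
      have "infnorm (z - (y - f x)) \<le> infnorm (z - (y - f x')) + infnorm ((y - f x') - (y - f x))"
        by (rule infnorm_triangle_sub)
      also have "\<dots> \<le> r' + r / 2" using z ff by (intro add_mono) auto
      finally have "z \<in> B" using r'c by (intro x(2)) simp
      moreover have "z \<in> R c" using z r'c by (intro x'(3)) simp
      ultimately show ?thesis using c(1) by (auto simp: B'_def)
    qed
    then show "\<exists>x\<in>A'. \<forall>z. infnorm (z - (y - f x)) \<le> r' \<longrightarrow> z \<in> B'" using x'(1) by blast
  qed
  then show ?thesis using cB' r' mB' by (intro exI[of _ B'] exI[of _ r']) (auto simp: B'_def)
qed

lemma continuous_on_unit_cube:
  assumes f: "f \<in> F"
  shows "continuous_on unit_cube f"
proof (rule continuous_onI)
  fix x :: "real^'n" and e :: real assume x: "x \<in> unit_cube" and e: "0 < e"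
  let ?s = "sqrt (real CARD('n))"
  have s: "0 < ?s" by simp
  have "dist (f x') (f x) \<le> e" if x': "x' \<in> unit_cube" and d: "dist x' x < e / ?s" for x'
  proof -
    have "norm (f x' - f x) \<le> ?s * infnorm (f x' - f x)" by (rule norm_le_sqrt_infnorm)
    also have "\<dots> \<le> ?s * norm (x' - x)"
      using infnorm_image_le[OF f x' x] infnorm_le_norm[of "x' - x"] by (intro mult_left_mono) auto
    also have "\<dots> \<le> ?s * (e / ?s)"
      using d by (intro mult_left_mono) (auto simp: dist_norm)
    also have "\<dots> = e" using s by simp
    finally show ?thesis by (simp add: dist_norm)
  qed
  then show "\<exists>d>0. \<forall>x'\<in>unit_cube. dist x' x < d \<longrightarrow> dist (f x') (f x) \<le> e"
    using e s by (intro exI[of _ "e / ?s"]) auto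
qed

text \<open>Refining with \<epsilon> = 1/k at the k-th step gives decreasing compact sets whose
  intersection has measure zero.\<close>

lemma null_summand:
  fixes N M :: "real \<Rightarrow> nat"
  assumes F0: "F \<noteq> {}"
    and NM_lim: "filterlim (\<lambda>\<delta>. real (N (C * \<delta>)) / ln (real (M \<delta>) / \<delta>)) at_top (at_right 0)"
    and cover: "\<forall>\<^sub>F \<delta> in at_right 0. fun_cover_num F \<delta> \<le> enat (M \<delta>)"
    and A': "compact A'" "A' \<noteq> {}" "A' \<subseteq> unit_cube"
    and large: "\<forall>Q. axis_cube Q \<and> A' \<inter> interior Q \<noteq> {} \<longrightarrow>
           Limsup (at_right 0)
             (\<lambda>\<delta>. ereal (real (ball_cover_num (A' \<inter> interior Q) \<delta>) / real (N \<delta>))) \<ge> 1"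
  shows "\<exists>B. compact B \<and> B \<in> null_sets lebesgue \<and>
    (\<forall>f\<in>F. \<forall>y\<in>unit_cube. \<exists>x\<in>A'. y - f x \<in> B)"
proof -
  obtain \<delta> where "fun_cover_num F \<delta> \<le> enat (M \<delta>)"
    using eventually_happens[OF cover] by auto
  then obtain L where L: "\<forall>f\<in>F. \<forall>x\<in>unit_cube. infnorm (f x) \<le> L"
    using uniformly_bounded by blast
  \<comment> \<open>The radius \<open>L + 2\<close> allows for \<open>infnorm y \<le> 1\<close>,
    \<open>infnorm (f x) \<le> L\<close> and the margin 1.\<close>
  define B\<^sub>0 where "B\<^sub>0 = cbox (0 - (L + 2) *\<^sub>R One) (0 + (L + 2) *\<^sub>R One :: real^'n)"
  have B\<^sub>0: "margin_hits 1 A' B\<^sub>0"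
    unfolding margin_hits_def
  proof (intro ballI)
    fix f and y :: "real^'n" assume f: "f \<in> F" and y: "y \<in> unit_cube"
    obtain x where x: "x \<in> A'" using A'(2) by blast
    have "z \<in> B\<^sub>0" if z: "infnorm (z - (y - f x)) \<le> 1" for z
    proof -
      have "infnorm (f x) \<le> L" using L f x A'(3) by blast
      moreover have "infnorm z \<le> infnorm (z - (y - f x)) + infnorm (y - f x)"
        "infnorm (y - f x) \<le> infnorm y + infnorm (f x)"
        using infnorm_triangle_sub[of z 0 "y - f x"] infnorm_triangle[of y "- f x"]
        by (simp_all add: infnorm_neg)
      ultimately have "infnorm (z - 0) \<le> L + 2"
        using z infnorm_le_1_unit_cube[OF y] by simp
      then show ?thesis unfolding B\<^sub>0_def mem_cbox_infnorm_iff .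
    qed
    then show "\<exists>x\<in>A'. \<forall>z. infnorm (z - (y - f x)) \<le> 1 \<longrightarrow> z \<in> B\<^sub>0" using x by blast
  qed
  \<comment> \<open>The guard \<open>0 < k\<close> is there because \<open>1 / real 0\<close> is 0,
    which would demand measure zero of the initial cube.\<close>
  let ?P = "\<lambda>k B. compact B \<and> (\<exists>r>0. margin_hits r A' B) \<and> (0 < k \<longrightarrow> measure lborel B \<le> 1 / real k)"
  have "\<exists>B. \<forall>k. ?P k (B k) \<and> B (Suc k) \<subseteq> B k"
  proof (rule dependent_nat_choice)
    show "\<exists>B. ?P 0 B"
      using B\<^sub>0 by (intro exI[of _ B\<^sub>0]) (auto simp: B\<^sub>0_def intro!: exI[of _ 1])
  next
    fix B k assume "?P k B"
    then obtain r where "compact B" "0 < r" "margin_hits r A' B" by blast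
    from refine_margin_hits[OF F0 L NM_lim cover A' large this, of "1 / real (Suc k)"]
    show "\<exists>B'. ?P (Suc k) B' \<and> B' \<subseteq> B" by auto
  qed
  then obtain B where B: "\<And>k. compact (B k)" "\<And>k. \<exists>r>0. margin_hits r A' (B k)"
    "\<And>k. 0 < k \<Longrightarrow> measure lborel (B k) \<le> 1 / real k" "\<And>k. B (Suc k) \<subseteq> B k"
    by blast
  have anti: "B k \<subseteq> B j" if "j \<le> k" for j k
    using that lift_Suc_antimono_le[of B, OF B(4)] by blast
  define B\<^sub>\<omega> where "B\<^sub>\<omega> = (\<Inter>k. B k)"
  have cB: "compact B\<^sub>\<omega>" unfolding B\<^sub>\<omega>_def using B(1) by (intro compact_Inter) auto
  have "measure lborel B\<^sub>\<omega> \<le> 1 / real (Suc k)" for k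
  proof -
    have "measure lborel B\<^sub>\<omega> \<le> measure lborel (B (Suc k))"
      using cB B(1) by (intro measure_mono_fmeasurable fmeasurable_compact)
        (auto simp: B\<^sub>\<omega>_def borel_compact)
    then show ?thesis using B(3)[of "Suc k"] by simp
  qed
  then have "measure lborel B\<^sub>\<omega> \<le> 0"
    by (intro LIMSEQ_le_const[OF LIMSEQ_Suc[OF lim_1_over_n]]) auto
  then have "measure lborel B\<^sub>\<omega> = 0" using measure_nonneg[of lborel B\<^sub>\<omega>] by linarith
  then have "B\<^sub>\<omega> \<in> null_sets lborel"
    using fmeasurable_compact[OF cB] by (intro null_setsI) (auto simp: emeasure_eq_measure2 fmeasurableD)
  then have null: "B\<^sub>\<omega> \<in> null_sets lebesgue" by (rule null_sets_completionI)
  have "\<exists>x\<in>A'. y - f x \<in> B\<^sub>\<omega>" if f: "f \<in> F" and y: "y \<in> unit_cube" for f y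
  proof -
    \<comment> \<open>The point of \<open>A'\<close> that hits \<open>B k\<close> depends on
      \<open>k\<close>, but the differences \<open>y - f x\<close> lying in \<open>B k\<close> form
      nested nonempty compact sets, and a point common to all of them comes from a single
      \<open>x\<close>.\<close>
    define D where "D k = (\<lambda>x. y - f x) ` A' \<inter> B k" for k
    have "compact ((\<lambda>x. y - f x) ` A')"
      using A'(1,3) continuous_on_subset[OF continuous_on_unit_cube[OF f]]
      by (intro compact_continuous_image continuous_intros) auto
    then have "compact (D k)" for k using B(1) by (simp add: D_def compact_Int)
    moreover have "D k \<noteq> {}" for k
    proof -
      obtain r where r: "0 < r" "margin_hits r A' (B k)" using B(2) by blast
      obtain x where x: "x \<in> A'" "\<And>z. infnorm (z - (y - f x)) \<le> r \<Longrightarrow> z \<in> B k"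
        using r(2) f y unfolding margin_hits_def by blast
      have "y - f x \<in> B k" using r(1) by (intro x(2)) (simp add: infnorm_0)
      then show ?thesis using x(1) by (auto simp: D_def)
    qed
    moreover have "D k \<subseteq> D j" if "j \<le> k" for j k using anti[OF that] by (auto simp: D_def)
    ultimately have "\<Inter>(range D) \<noteq> {}" by (rule compact_nest)
    then obtain z where z: "\<And>k. z \<in> D k" by blast
    then obtain x where "x \<in> A'" "z = y - f x" by (auto simp: D_def)
    moreover have "z \<in> B\<^sub>\<omega>" using z by (auto simp: B\<^sub>\<omega>_def D_def)
    ultimately show ?thesis by blast
  qed
  then show ?thesis using cB null by blast
qed

end

theorem theorem3:
  fixes C :: real and N M :: "real \<Rightarrow> nat"
    and F :: "((real^'n) \<Rightarrow> (real^'n)) set" and A :: "(real^'n) set"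
  assumes C_ge: "C \<ge> 1"
    and N_infty: "filterlim N at_top (at_right 0)"
    and NM_lim: "filterlim (\<lambda>\<delta>. real (N (C * \<delta>)) / ln (real (M \<delta>) / \<delta>)) at_top (at_right 0)"
    and bilip: "\<forall>f\<in>F. \<forall>x\<in>unit_cube. \<forall>y\<in>unit_cube.
                  infnorm (x - y) / C \<le> infnorm (f x - f y) \<and>
                  infnorm (f x - f y) \<le> infnorm (x - y)"
    and cover: "\<forall>\<^sub>F \<delta> in at_right 0. fun_cover_num F \<delta> \<le> enat (M \<delta>)"
    and A_sub: "A \<subseteq> unit_cube"
    and A_large: "N_large N A"
  shows "\<exists>B::(real^'n) set. compact B \<and> B \<in> null_sets lebesgue \<and>
           (\<forall>f\<in>F. unit_cube \<subseteq> {u + v | u v. u \<in> f ` A \<and> v \<in> B})"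
proof (cases "F = {}")
  \<comment> \<open>The argument for the other case picks a member of \<open>F\<close>, so the empty
    family is treated apart.\<close>
  case True
  then show ?thesis by (intro exI[of _ "{}"]) auto
next
  case False
  interpret bilipschitz_family C F by unfold_locales (fact C_ge bilip)+
  obtain A' where A': "A' \<noteq> {}" "compact A'" "A' \<subseteq> A"
    and large: "\<forall>Q. axis_cube Q \<and> A' \<inter> interior Q \<noteq> {} \<longrightarrow>
           Limsup (at_right 0)
             (\<lambda>\<delta>. ereal (real (ball_cover_num (A' \<inter> interior Q) \<delta>) / real (N \<delta>))) \<ge> 1"
    using A_large unfolding N_large_def by blast
  obtain B where B: "compact B" "B \<in> null_sets lebesgue"
    "\<And>f y. f \<in> F \<Longrightarrow> y \<in> unit_cube \<Longrightarrow> \<exists>x\<in>A'. y - f x \<in> B"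
    using null_summand[OF False NM_lim cover A'(2,1) order_trans[OF A'(3) A_sub] large] by blast
  have "unit_cube \<subseteq> {u + v | u v. u \<in> f ` A \<and> v \<in> B}" if f: "f \<in> F" for f
  proof
    fix y :: "real^'n" assume "y \<in> unit_cube"
    then obtain x where x: "x \<in> A'" "y - f x \<in> B" using B(3)[OF f] by blast
    moreover have "y = f x + (y - f x)" by simp
    ultimately show "y \<in> {u + v | u v. u \<in> f ` A \<and> v \<in> B}" using A'(3) by blast
  qed
  then show ?thesis using B(1,2) by blast
qed

end
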